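(* Assume $\vec u$ is a Fraïssé sequence in a category $\mathfrak K$ with the amalgamation property. Then for every countable inductive sequence $\vec x$ in $\mathfrak K$ there exists a morphism of sequences $F\colon\vec x\to\vec u$.
   Context: $\mathfrak K(a,b)$ is the set of arrows from $a$ to $b$. An inductive sequence of length $\delta$ ($\delta>0$ an ordinal) in $\mathfrak K$ is a functor $\vec a\colon\delta\to\mathfrak K$: objects $a_\xi$ ($\xi<\delta$) and arrows $a_\xi^\eta\colon a_\xi\to a_\eta$ ($\xi\leq\eta<\delta$) with $a_\xi^\xi=\mathrm{id}$ and $a_\eta^\rho\circ a_\xi^\eta=a_\xi^\rho$. It is countable if $\delta$ is countable. $\mathfrak K$ has the amalgamation property if for all arrows $f\colon a\to b$, $g\colon a\to c$ there are arrows $f'\colon b\to d$, $g'\colon c\to d$ with $f'\circ f=g'\circ g$. A Fraïssé sequence in $\mathfrak K$ is an inductive sequence $\vec u$ whose length is a cardinal $\kappa$ such that (U) for every object $x$ there is $\xi<\kappa$ with $\mathfrak K(x,u_\xi)\neq\emptyset$; (A) for every $\xi<\kappa$ and every arrow $f\colon u_\xi\to y$ there are $\eta\geq\xi$, $\eta<\kappa$, and $g\colon y\to u_\eta$ with $u_\xi^\eta=g\circ f$. A morphism of sequences $\vec x\to\vec u$ (of lengths $\lambda$, $\kappa$) is represented by an order preserving (i.e. non-decreasing) map $\varphi\colon\lambda\to\kappa$ and arrows $f_\alpha\colon x_\alpha\to u_{\varphi(\alpha)}$ ($\alpha<\lambda$) with $f_\beta\circ x_\alpha^\beta=u_{\varphi(\alpha)}^{\varphi(\beta)}\circ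 f_\alpha$ for $\alpha\leq\beta<\lambda$. (Morphisms are equivalence classes of such data; for the existence of a morphism the equivalence relation plays no role.) *)

theory Defs
  imports Main "HOL-Library.Countable_Set"
begin

record ('o, 'm) cat_data =
  obj :: "'o set"
  arr :: "'m set"
  src :: "'m \<Rightarrow> 'o"
  tgt :: "'m \<Rightarrow> 'o"
  ident :: "'o \<Rightarrow> 'm"
  comp :: "'m \<Rightarrow> 'm \<Rightarrow> 'm"  (infixr "\<cdot>\<index>" 70)

definition hom :: "('o, 'm) cat_data \<Rightarrow> 'o \<Rightarrow> 'o \<Rightarrow> 'm set" where
  "hom C a b = {f \<in> arr C. src C f = a \<and> tgt C f = b}"

text \<open>Composition is written in the usual order: \<open>g \<cdot> f\<close> is \<open>g\<close> after \<open>f\<close>.\<close>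

locale category =
  fixes C :: "('o, 'm) cat_data" (structure)
  assumes src_obj: "f \<in> arr C \<Longrightarrow> src C f \<in> obj C"
    and tgt_obj: "f \<in> arr C \<Longrightarrow> tgt C f \<in> obj C"
    and ident_hom: "a \<in> obj C \<Longrightarrow> ident C a \<in> hom C a a"
    and comp_hom: "f \<in> hom C a b \<Longrightarrow> g \<in> hom C b c \<Longrightarrow> g \<cdot> f \<in> hom C a c"
    and comp_ident: "f \<in> hom C a b \<Longrightarrow> f \<cdot> ident C a = f"
    and ident_comp: "f \<in> hom C a b \<Longrightarrow> ident C b \<cdot> f = f"
    and comp_assoc:
      "f \<in> hom C a b \<Longrightarrow> g \<in> hom C b c \<Longrightarrow> h \<in> hom C c d \<Longrightarrow> (h \<cdot> g) \<cdot> f = h \<cdot> (g \<cdot> f)"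

definition amalgamation_property :: "('o, 'm) cat_data \<Rightarrow> bool" where
  "amalgamation_property C \<longleftrightarrow>
    (\<forall>a b c f g. f \<in> hom C a b \<longrightarrow> g \<in> hom C a c \<longrightarrow>
      (\<exists>d f' g'. f' \<in> hom C b d \<and> g' \<in> hom C c d \<and> f' \<cdot>\<^bsub>C\<^esub> f = g' \<cdot>\<^bsub>C\<^esub> g))"

text \<open>
  An ordinal is represented by a well-order \<open>len X\<close>, whose field plays the role of the set of
  smaller ordinals; \<open>(\<xi>, \<eta>) \<in> len X\<close> means \<open>\<xi> \<le> \<eta>\<close>. The arrow from the \<open>\<xi>\<close>-th to the \<open>\<eta>\<close>-th
  object is \<open>bond X \<xi> \<eta>\<close>.
\<close>

record ('i, 'o, 'm) seq_data =
  len :: "'i rel"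
  at :: "'i \<Rightarrow> 'o"
  bond :: "'i \<Rightarrow> 'i \<Rightarrow> 'm"

definition inductive_sequence :: "('o, 'm) cat_data \<Rightarrow> ('i, 'o, 'm) seq_data \<Rightarrow> bool" where
  "inductive_sequence C X \<longleftrightarrow>
    Well_order (len X) \<and> Field (len X) \<noteq> {} \<and>
    (\<forall>\<xi>\<in>Field (len X). at X \<xi> \<in> obj C) \<and>
    (\<forall>\<xi> \<eta>. (\<xi>, \<eta>) \<in> len X \<longrightarrow> bond X \<xi> \<eta> \<in> hom C (at X \<xi>) (at X \<eta>)) \<and>
    (\<forall>\<xi>\<in>Field (len X). bond X \<xi> \<xi> = ident C (at X \<xi>)) \<and>
    (\<forall>\<xi> \<eta> \<rho>. (\<xi>, \<eta>) \<in> len X \<longrightarrow> (\<eta>, \<rho>) \<in> len X \<longrightarrow>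
      bond X \<eta> \<rho> \<cdot>\<^bsub>C\<^esub> bond X \<xi> \<eta> = bond X \<xi> \<rho>)"

definition countable_sequence :: "('i, 'o, 'm) seq_data \<Rightarrow> bool" where
  "countable_sequence X \<longleftrightarrow> countable (Field (len X))"

text \<open>\<open>Card_order (len U)\<close> says that the length of \<open>U\<close> is a cardinal, i.e. an initial ordinal.\<close>

definition fraisse_sequence :: "('o, 'm) cat_data \<Rightarrow> ('k, 'o, 'm) seq_data \<Rightarrow> bool" where
  "fraisse_sequence C U \<longleftrightarrow>
    inductive_sequence C U \<and> Card_order (len U) \<and>
    (\<forall>x\<in>obj C. \<exists>\<xi>\<in>Field (len U). hom C x (at U \<xi>) \<noteq> {}) \<and>
    (\<forall>\<xi>\<in>Field (len U). \<forall>y f. f \<in> hom C (at U \<xi>) y \<longrightarrow>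
      (\<exists>\<eta> g. (\<xi>, \<eta>) \<in> len U \<and> g \<in> hom C y (at U \<eta>) \<and> bond U \<xi> \<eta> = g \<cdot>\<^bsub>C\<^esub> f))"

text \<open>
  Morphisms of sequences are equivalence classes of the following data; a morphism exists if and
  only if such data exist.
\<close>

definition seq_morphism ::
  "('o, 'm) cat_data \<Rightarrow> ('i, 'o, 'm) seq_data \<Rightarrow> ('k, 'o, 'm) seq_data \<Rightarrow>
    ('i \<Rightarrow> 'k) \<Rightarrow> ('i \<Rightarrow> 'm) \<Rightarrow> bool" where
  "seq_morphism C X U \<phi> f \<longleftrightarrow>
    (\<forall>\<alpha>\<in>Field (len X). \<phi> \<alpha> \<in> Field (len U)) \<and>
    (\<forall>\<alpha> \<beta>. (\<alpha>, \<beta>) \<in> len X \<longrightarrow> (\<phi> \<alpha>, \<phi> \<beta>) \<in> len U) \<and>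
    (\<forall>\<alpha>\<in>Field (len X). f \<alpha> \<in> hom C (at X \<alpha>) (at U (\<phi> \<alpha>))) \<and>
    (\<forall>\<alpha> \<beta>. (\<alpha>, \<beta>) \<in> len X \<longrightarrow>
      f \<beta> \<cdot>\<^bsub>C\<^esub> bond X \<alpha> \<beta> = bond U (\<phi> \<alpha>) (\<phi> \<beta>) \<cdot>\<^bsub>C\<^esub> f \<alpha>)"

end

theory Submission
  imports Defs
begin

text \<open>
  A countable linear order has a non-decreasing cofinal sequence \<open>a 0 \<le> a 1 \<le> \<dots>\<close>: the running
  maxima of an enumeration (\<open>monotone_cofinal_enumeration\<close>). Such a sequence is eventually constant
  if there is a largest element, so successor and limit lengths of \<open>X\<close> need no separate treatment.

  Along this sequence the arrows \<open>h n\<close> from \<open>at X (a n)\<close> to \<open>at U (k n)\<close> are built by recursion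
  (\<open>cofinal_ladder\<close>). Condition (U) gives \<open>h 0\<close>. To pass from \<open>n\<close> to \<open>n + 1\<close>, amalgamate \<open>h n\<close>
  with the bond of \<open>X\<close> from \<open>a n\<close> to \<open>a (n + 1)\<close>; this yields an arrow from \<open>at U (k n)\<close> to some
  \<open>d\<close>, which condition (A) absorbs into the sequence \<open>U\<close> (\<open>fraisse_extend\<close>).

  At an arbitrary index \<open>\<xi>\<close> of \<open>X\<close> the morphism goes first to the least \<open>a n\<close> above \<open>\<xi>\<close> and then
  along \<open>h n\<close>. Taking the least such \<open>n\<close> makes the choice non-decreasing in \<open>\<xi>\<close>, and naturality
  reduces to the commutativity of the ladder.
\<close>

lemma monotone_cofinal_enumeration:
  assumes lin: "Linear_order r" and cnt: "countable (Field r)" and ne: "Field r \<noteq> {}"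
  obtains a :: "nat \<Rightarrow> 'i"
  where "\<And>n m. n \<le> m \<Longrightarrow> (a n, a m) \<in> r"
    and "\<And>\<xi>. \<xi> \<in> Field r \<Longrightarrow> \<exists>n. (\<xi>, a n) \<in> r"
proof -
  have refl: "(x, x) \<in> r" if "x \<in> Field r" for x
    using lin that by (auto simp: order_on_defs refl_on_def)
  have trans: "(x, z) \<in> r" if "(x, y) \<in> r" "(y, z) \<in> r" for x y z
    using lin that by (auto simp: order_on_defs dest: transD)
  have total: "(x, y) \<in> r \<or> (y, x) \<in> r" if "x \<in> Field r" "y \<in> Field r" for x y
    using lin that refl by (cases "x = y") (auto simp: order_on_defs total_on_def)
  define e where "e = from_nat_into (Field r)"
  have e_Field: "e n \<in> Field r" for n
    unfolding e_def by (rule from_nat_into[OF ne])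
  \<comment> \<open>The maximum of \<open>e 0, \<dots>, e n\<close>.\<close>
  define a where "a = rec_nat (e 0) (\<lambda>n y. if (y, e (Suc n)) \<in> r then e (Suc n) else y)"
  have a_0: "a 0 = e 0"
    and a_Suc: "a (Suc n) = (if (a n, e (Suc n)) \<in> r then e (Suc n) else a n)" for n
    by (simp_all add: a_def)
  have a_Field: "a n \<in> Field r" for n
    by (induction n) (auto simp: a_0 a_Suc e_Field)
  have step: "(a n, a (Suc n)) \<in> r" for n
    using refl[OF a_Field[of n]] by (simp add: a_Suc)
  have mono: "(a n, a m) \<in> r" if "n \<le> m" for n m
    using that by (induction m rule: dec_induct) (use refl[OF a_Field] trans[OF _ step] in blast)+
  have e_le: "(e n, a n) \<in> r" for n
  proof (cases n)
    case 0
    then show ?thesis by (simp add: a_0 refl e_Field)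
  next
    case (Suc m)
    then show ?thesis
      using total[OF a_Field[of m] e_Field[of n]] refl[OF e_Field[of n]] by (auto simp: a_Suc)
  qed
  have "\<exists>n. (\<xi>, a n) \<in> r" if \<xi>: "\<xi> \<in> Field r" for \<xi>
  proof -
    obtain n where "\<xi> = e n"
      using from_nat_into_surj[OF cnt \<xi>] unfolding e_def by metis
    then show ?thesis using e_le by blast
  qed
  with mono show thesis by (rule that)
qed

context category
begin

text \<open>
  Amalgamate \<open>h\<close> and \<open>p\<close> to get arrows from \<open>at U k\<close> and \<open>y\<close> to a common object \<open>d\<close>. Condition (A)
  turns the first one into a bond of \<open>U\<close> and thereby carries the second one into \<open>U\<close>.
\<close>

lemma fraisse_extend:
  assumes amalg: "amalgamation_property C" and fraisse: "fraisse_sequence C U"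
    and k: "k \<in> Field (len U)" and h: "h \<in> hom C x (at U k)" and p: "p \<in> hom C x y"
  shows "\<exists>l h'. (k, l) \<in> len U \<and> h' \<in> hom C y (at U l) \<and> h' \<cdot> p = bond U k l \<cdot> h"
proof -
  obtain d f' g' where f': "f' \<in> hom C (at U k) d" and g': "g' \<in> hom C y d"
    and amalgam: "f' \<cdot> h = g' \<cdot> p"
    using amalg h p unfolding amalgamation_property_def by blast
  obtain l g where l: "(k, l) \<in> len U" and g: "g \<in> hom C d (at U l)"
    and absorb: "bond U k l = g \<cdot> f'"
    using fraisse k f' unfolding fraisse_sequence_def by blast
  have "(g \<cdot> g') \<cdot> p = g \<cdot> (f' \<cdot> h)"
    using comp_assoc[OF p g' g] amalgam by simp
  also have "\<dots> = bond U k l \<cdot> h"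
    using comp_assoc[OF h f' g] absorb by simp
  finally show ?thesis
    using l comp_hom[OF g' g] by blast
qed

text \<open>
  The recursion from \<open>n\<close> to \<open>n + 1\<close> only makes neighbouring squares commute; pasting them gives the
  square between any two rungs \<open>n \<le> m\<close>.
\<close>

lemma cofinal_ladder:
  fixes U :: "('k, 'o, 'm) seq_data" and a :: "nat \<Rightarrow> 'i"
  assumes amalg: "amalgamation_property C" and fraisse: "fraisse_sequence C U"
    and X: "inductive_sequence C X"
    and mono: "\<And>n m. n \<le> m \<Longrightarrow> (a n, a m) \<in> len X"
  obtains k h
  where "\<And>n. h n \<in> hom C (at X (a n)) (at U (k n))"
    and "\<And>n m. n \<le> m \<Longrightarrow> (k n, k m) \<in> len U"
    and "\<And>n m. n \<le> m \<Longrightarrow> h m \<cdot> bond X (a n) (a m) = bond U (k n) (k m) \<cdot> h n"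
proof -
  have U: "inductive_sequence C U"
    using fraisse by (simp add: fraisse_sequence_def)
  have bond_X: "bond X \<xi> \<eta> \<in> hom C (at X \<xi>) (at X \<eta>)" if "(\<xi>, \<eta>) \<in> len X" for \<xi> \<eta>
    using X that by (simp add: inductive_sequence_def)
  have bond_U: "bond U \<xi> \<eta> \<in> hom C (at U \<xi>) (at U \<eta>)" if "(\<xi>, \<eta>) \<in> len U" for \<xi> \<eta>
    using U that by (simp add: inductive_sequence_def)
  have a_Field: "a n \<in> Field (len X)" for n
    using mono[of n n] by (auto intro: FieldI1)
  define rung where "rung n q \<longleftrightarrow> fst q \<in> Field (len U) \<and> snd q \<in> hom C (at X (a n)) (at U (fst q))"
    for n and q :: "'k \<times> 'm"
  define square where "square n q q' \<longleftrightarrow> (fst q, fst q') \<in> len U \<and>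
      snd q' \<cdot> bond X (a n) (a (Suc n)) = bond U (fst q) (fst q') \<cdot> snd q"
    for n and q q' :: "'k \<times> 'm"
  have "\<exists>q. \<forall>n. rung n (q n) \<and> square n (q n) (q (Suc n))"
  proof (rule dependent_nat_choice)
    have "at X (a 0) \<in> obj C"
      using X a_Field by (simp add: inductive_sequence_def)
    then obtain l g where "l \<in> Field (len U)" "g \<in> hom C (at X (a 0)) (at U l)"
      using fraisse unfolding fraisse_sequence_def by blast
    then show "\<exists>q. rung 0 q"
      by (auto simp: rung_def)
  next
    fix q n
    assume "rung n q"
    then obtain l g where "(fst q, l) \<in> len U" "g \<in> hom C (at X (a (Suc n))) (at U l)"
      "g \<cdot> bond X (a n) (a (Suc n)) = bond U (fst q) l \<cdot> snd q"
      using fraisse_extend[OF amalg fraisse _ _ bond_X[OF mono[of n "Suc n"]], of "fst q" "snd q"]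
      unfolding rung_def by auto
    then show "\<exists>q'. rung (Suc n) q' \<and> square n q q'"
      by (intro exI[of _ "(l, g)"]) (auto simp: rung_def square_def intro: FieldI2)
  qed
  then obtain q where q: "\<And>n. rung n (q n)" "\<And>n. square n (q n) (q (Suc n))"
    by blast
  define k where "k = fst \<circ> q"
  define h where "h = snd \<circ> q"
  have k: "k n \<in> Field (len U)" and h: "h n \<in> hom C (at X (a n)) (at U (k n))"
    and k_step: "(k n, k (Suc n)) \<in> len U"
    and h_step: "h (Suc n) \<cdot> bond X (a n) (a (Suc n)) = bond U (k n) (k (Suc n)) \<cdot> h n" for n
    using q[of n] by (simp_all add: rung_def square_def k_def h_def)
  have ladder: "(k n, k m) \<in> len U \<and> h m \<cdot> bond X (a n) (a m) = bond U (k n) (k m) \<cdot> h n"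
    if "n \<le> m" for n m
    using that
  proof (induction m rule: dec_induct)
    case base
    have "(k n, k n) \<in> len U"
      using U k[of n] by (auto simp: inductive_sequence_def order_on_defs refl_on_def)
    moreover have "bond X (a n) (a n) = ident C (at X (a n))"
      "bond U (k n) (k n) = ident C (at U (k n))"
      using X U a_Field k by (auto simp: inductive_sequence_def)
    ultimately show ?case
      using comp_ident[OF h[of n]] ident_comp[OF h[of n]] by simp
  next
    case (step m)
    have k_nm: "(k n, k m) \<in> len U"
      using step.IH by blast
    have "(k n, k (Suc m)) \<in> len U"
      using U k_nm k_step[of m]
      by (auto simp: inductive_sequence_def order_on_defs dest: transD)
    moreover have "h (Suc m) \<cdot> bond X (a n) (a (Suc m)) = bond U (k n) (k (Suc m)) \<cdot> h n"
    proof -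
      have a_nm: "(a n, a m) \<in> len X" and a_m: "(a m, a (Suc m)) \<in> len X"
        using step.hyps mono by auto
      have "h (Suc m) \<cdot> bond X (a n) (a (Suc m)) =
          h (Suc m) \<cdot> (bond X (a m) (a (Suc m)) \<cdot> bond X (a n) (a m))"
        using X a_nm a_m by (simp add: inductive_sequence_def)
      also have "\<dots> = (bond U (k m) (k (Suc m)) \<cdot> h m) \<cdot> bond X (a n) (a m)"
        using comp_assoc[OF bond_X[OF a_nm] bond_X[OF a_m] h] h_step by simp
      also have "\<dots> = bond U (k m) (k (Suc m)) \<cdot> (bond U (k n) (k m) \<cdot> h n)"
        using comp_assoc[OF bond_X[OF a_nm] h bond_U[OF k_step]] step.IH by simp
      also have "\<dots> = (bond U (k m) (k (Suc m)) \<cdot> bond U (k n) (k m)) \<cdot> h n"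
        using comp_assoc[OF h bond_U[OF k_nm] bond_U[OF k_step]] by simp
      also have "\<dots> = bond U (k n) (k (Suc m)) \<cdot> h n"
        using U k_nm k_step[of m] by (simp add: inductive_sequence_def)
      finally show ?thesis .
    qed
    ultimately show ?case by blast
  qed
  show thesis
    by (rule that[of h k]) (use h ladder in auto)
qed

end

theorem theorem3p11:
  fixes C :: "('o, 'm) cat_data"
    and U :: "('k, 'o, 'm) seq_data"
    and X :: "('i, 'o, 'm) seq_data"
  assumes "category C"
    and "amalgamation_property C"
    and "fraisse_sequence C U"
    and "inductive_sequence C X"
    and "countable_sequence X"
  shows "\<exists>\<phi> f. seq_morphism C X U \<phi> f"
proof -
  interpret category C by fact
  note X = assms(4)
  have U: "inductive_sequence C U"
    using assms(3) by (simp add: fraisse_sequence_def)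
  have lin: "Linear_order (len X)" and ne: "Field (len X) \<noteq> {}"
    using X by (auto simp: inductive_sequence_def well_order_on_def)
  have cnt: "countable (Field (len X))"
    using assms(5) by (simp add: countable_sequence_def)
  have trans: "(\<xi>, \<rho>) \<in> len X" if "(\<xi>, \<eta>) \<in> len X" "(\<eta>, \<rho>) \<in> len X" for \<xi> \<eta> \<rho>
    using lin that by (auto simp: order_on_defs dest: transD)
  have bond_X: "bond X \<xi> \<eta> \<in> hom C (at X \<xi>) (at X \<eta>)" if "(\<xi>, \<eta>) \<in> len X" for \<xi> \<eta>
    using X that by (simp add: inductive_sequence_def)
  have bond_X_comp: "bond X \<eta> \<rho> \<cdot>\<^bsub>C\<^esub> bond X \<xi> \<eta> = bond X \<xi> \<rho>"
    if "(\<xi>, \<eta>) \<in> len X" "(\<eta>, \<rho>) \<in> len X" for \<xi> \<eta> \<rho>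
    using X that by (simp add: inductive_sequence_def)
  have bond_U: "bond U \<xi> \<eta> \<in> hom C (at U \<xi>) (at U \<eta>)" if "(\<xi>, \<eta>) \<in> len U" for \<xi> \<eta>
    using U that by (simp add: inductive_sequence_def)
  obtain a where a_mono: "\<And>n m :: nat. n \<le> m \<Longrightarrow> (a n, a m) \<in> len X"
    and a_cofinal: "\<And>\<xi>. \<xi> \<in> Field (len X) \<Longrightarrow> \<exists>n. (\<xi>, a n) \<in> len X"
    using monotone_cofinal_enumeration[OF lin cnt ne] by blast
  obtain k h where h: "\<And>n. h n \<in> hom C (at X (a n)) (at U (k n))"
    and k_mono: "\<And>n m. n \<le> m \<Longrightarrow> (k n, k m) \<in> len U"
    and h_square: "\<And>n m. n \<le> m \<Longrightarrow>
      h m \<cdot>\<^bsub>C\<^esub> bond X (a n) (a m) = bond U (k n) (k m) \<cdot>\<^bsub>C\<^esub> h n"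
    by (rule cofinal_ladder[where a = a, OF assms(2,3) X]) (erule a_mono, rule that)
  define N where "N \<xi> = (LEAST n. (\<xi>, a n) \<in> len X)" for \<xi>
  have N: "(\<xi>, a (N \<xi>)) \<in> len X" if "\<xi> \<in> Field (len X)" for \<xi>
    unfolding N_def using a_cofinal[OF that] by (rule LeastI_ex)
  have N_mono: "N \<alpha> \<le> N \<beta>" if "(\<alpha>, \<beta>) \<in> len X" for \<alpha> \<beta>
    using trans[OF that N[OF FieldI2[OF that]]] unfolding N_def[of \<alpha>] by (rule Least_le)
  define f where "f \<xi> = h (N \<xi>) \<cdot>\<^bsub>C\<^esub> bond X \<xi> (a (N \<xi>))" for \<xi>
  have f: "f \<xi> \<in> hom C (at X \<xi>) (at U (k (N \<xi>)))" if "\<xi> \<in> Field (len X)" for \<xi>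
    unfolding f_def by (rule comp_hom[OF bond_X[OF N[OF that]] h])
  have natural: "f \<beta> \<cdot>\<^bsub>C\<^esub> bond X \<alpha> \<beta> = bond U (k (N \<alpha>)) (k (N \<beta>)) \<cdot>\<^bsub>C\<^esub> f \<alpha>"
    if le: "(\<alpha>, \<beta>) \<in> len X" for \<alpha> \<beta>
  proof -
    note N\<alpha> = N[OF FieldI1[OF le]] and N\<beta> = N[OF FieldI2[OF le]] and NN = N_mono[OF le]
    have "f \<beta> \<cdot>\<^bsub>C\<^esub> bond X \<alpha> \<beta> = h (N \<beta>) \<cdot>\<^bsub>C\<^esub> bond X \<alpha> (a (N \<beta>))"
      unfolding f_def using comp_assoc[OF bond_X[OF le] bond_X[OF N\<beta>] h] bond_X_comp[OF le N\<beta>]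
      by simp
    also have "\<dots> = h (N \<beta>) \<cdot>\<^bsub>C\<^esub> (bond X (a (N \<alpha>)) (a (N \<beta>)) \<cdot>\<^bsub>C\<^esub> bond X \<alpha> (a (N \<alpha>)))"
      using bond_X_comp[OF N\<alpha> a_mono[OF NN]] by simp
    also have "\<dots> = (bond U (k (N \<alpha>)) (k (N \<beta>)) \<cdot>\<^bsub>C\<^esub> h (N \<alpha>)) \<cdot>\<^bsub>C\<^esub> bond X \<alpha> (a (N \<alpha>))"
      using comp_assoc[OF bond_X[OF N\<alpha>] bond_X[OF a_mono[OF NN]] h] h_square[OF NN] by simp
    also have "\<dots> = bond U (k (N \<alpha>)) (k (N \<beta>)) \<cdot>\<^bsub>C\<^esub> f \<alpha>"
      unfolding f_def using comp_assoc[OF bond_X[OF N\<alpha>] h bond_U[OF k_mono[OF NN]]] by simp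
    finally show ?thesis .
  qed
  have "seq_morphism C X U (\<lambda>\<xi>. k (N \<xi>)) f"
    unfolding seq_morphism_def
    by (intro conjI ballI allI impI f natural k_mono N_mono FieldI1[OF k_mono[OF order_refl]])
  then show ?thesis by blast
qed

end
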